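(* The competitive ratio of any deterministic online algorithm for online unit-length busy time scheduling on heterogeneous machines is at least 2; that is, for every deterministic online algorithm $\mathcal{A}$ and every $\alpha<2$ there is an instance on which the cost of $\mathcal{A}$ exceeds $\alpha\cdot\mathrm{cost}(\mathsf{OPT})$.
   Context: Online unit-length busy time scheduling on heterogeneous machines: there are finitely many machine types, with an unlimited number of machines of each type; a machine of type $k$ has capacity $B_k\in\mathbb{Z}_{\ge 1}$ and cost $c_k\ge 1$ per time step in which it executes at least one job. A set $J$ of unit-length jobs is given online: job $j$ has an integer release time $r_j$ and an integer deadline $d_j\ge r_j$, both revealed at time $r_j$. A batch $X$ consists of a set of jobs $J(X)$, a type $t(X)$ and an integer execution time $\tau(X)$; a feasible schedule is a partition of $J$ into batches with $|J(X)|\le B_{t(X)}$ and $r_j\le\tau(X)\le d_j$ for $j\in J(X)$, with cost $\sum_X c_{t(X)}$. $\mathsf{OPT}$ is a minimum-cost feasible schedule computed offline. An online algorithm, at each integer time $\tau$ and knowing only the jobs released up to $\tau$, irrevocably decides which batches to execute at $\tau$. Its competitive ratio is the supremum over instances of its cost divided by $\mathrm{cost}(\mathsf{OPT})$; the adversary choosing the instance may adapt to the (deterministic) algorithm's decisions. *)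

theory Defs
  imports "HOL-Library.Disjoint_Sets" "HOL-Library.Extended_Real"
begin

record machine_type =
  capacity :: nat
  price :: real

text \<open>The label allows different jobs to have the same release time and deadline.\<close>

record job =
  label :: nat
  release :: int
  deadline :: int

text \<open>The field \<open>btype\<close> is a position in the list of machine types.\<close>

record batch =
  bjobs :: "job set"
  btype :: nat
  btime :: int

definition valid_instance :: "machine_type list \<Rightarrow> job set \<Rightarrow> bool" where
  "valid_instance M J \<longleftrightarrow>
     M \<noteq> [] \<and> (\<forall>m \<in> set M. 1 \<le> capacity m \<and> 1 \<le> price m) \<and>
     finite J \<and> (\<forall>j \<in> J. release j \<le> deadline j)"

text \<open>Injectivity of \<open>bjobs\<close> is needed in addition to \<open>partition_on\<close>: it prevents the same set
  of jobs from being executed twice, with different types or at different times.\<close>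

definition feasible :: "machine_type list \<Rightarrow> job set \<Rightarrow> batch set \<Rightarrow> bool" where
  "feasible M J S \<longleftrightarrow>
     partition_on J (bjobs ` S) \<and> inj_on bjobs S \<and>
     (\<forall>X \<in> S. btype X < length M \<and> card (bjobs X) \<le> capacity (M ! btype X) \<and>
        (\<forall>j \<in> bjobs X. release j \<le> btime X \<and> btime X \<le> deadline j))"

definition cost :: "machine_type list \<Rightarrow> batch set \<Rightarrow> real" where
  "cost M S = (\<Sum>X\<in>S. price (M ! btype X))"

definition OPT :: "machine_type list \<Rightarrow> job set \<Rightarrow> batch set" where
  "OPT M J = (ARG_MIN (cost M) S. feasible M J S)"

text \<open>The arguments are the machine types, the current time, and the set of jobs released so far;
  the result is the set of batches (job set and machine type) executed at the current time.
  Earlier decisions need not be an argument, since a deterministic algorithm can recompute them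
  from the jobs released so far.\<close>

type_synonym algorithm = "machine_type list \<Rightarrow> int \<Rightarrow> job set \<Rightarrow> (job set \<times> nat) set"

definition schedule_of :: "algorithm \<Rightarrow> machine_type list \<Rightarrow> job set \<Rightarrow> batch set" where
  "schedule_of A M J =
     {\<lparr>bjobs = P, btype = k, btime = \<tau>\<rparr> | P k \<tau>. (P, k) \<in> A M \<tau> {j \<in> J. release j \<le> \<tau>}}"

definition online_algorithm :: "algorithm \<Rightarrow> bool" where
  "online_algorithm A \<longleftrightarrow> (\<forall>M J. valid_instance M J \<longrightarrow> feasible M J (schedule_of A M J))"

text \<open>The empty job set is excluded from the supremum, since its optimal cost is \<open>0\<close>.\<close>

definition competitive_ratio :: "algorithm \<Rightarrow> ereal" where
  "competitive_ratio A =
     (SUP (M, J) \<in> {(M, J). valid_instance M J \<and> J \<noteq> {}}.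
        ereal (cost M (schedule_of A M J) / cost M (OPT M J)))"

lemma finite_feasible:
  assumes "valid_instance M J"
  shows "finite {S. feasible M J S}"
proof -
  have J: "finite J" using assms by (simp add: valid_instance_def)
  define T where "T = (\<Union>j\<in>J. {release j..deadline j})"
  define U where "U = (\<lambda>(P, k, t). \<lparr>bjobs = P, btype = k, btime = t\<rparr>) ` (Pow J \<times> {..<length M} \<times> T)"
  have "finite U" using J by (auto simp: U_def T_def)
  moreover have "S \<subseteq> U" if S: "feasible M J S" for S
  proof
    fix X assume X: "X \<in> S"
    have ne: "bjobs X \<noteq> {}" and sub: "bjobs X \<subseteq> J"
      using S X by (auto simp: feasible_def partition_on_def)
    then obtain j where j: "j \<in> bjobs X" by auto
    have "btime X \<in> T" using S X j sub by (fastforce simp: feasible_def T_def)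
    moreover have "btype X < length M" using S X by (simp add: feasible_def)
    moreover have "X = \<lparr>bjobs = bjobs X, btype = btype X, btime = btime X\<rparr>" by simp
    ultimately show "X \<in> U" using sub unfolding U_def
      by (intro image_eqI[where x = "(bjobs X, btype X, btime X)"]) auto
  qed
  then have "{S. feasible M J S} \<subseteq> Pow U" by auto
  ultimately show ?thesis by (meson finite_Pow_iff finite_subset)
qed

lemma feasible_exists:
  assumes "valid_instance M J"
  shows "\<exists>S. feasible M J S"
proof -
  let ?S = "(\<lambda>j. \<lparr>bjobs = {j}, btype = 0, btime = release j\<rparr>) ` J"
  have "1 \<le> capacity (M ! 0)" "0 < length M"
    using assms by (auto simp: valid_instance_def)
  then have "feasible M J ?S"
    using assms unfolding feasible_def partition_on_def disjoint_def inj_on_def valid_instance_def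
    by auto
  then show ?thesis ..
qed

lemma OPT_optimal:
  assumes "valid_instance M J"
  shows "feasible M J (OPT M J)"
    and "feasible M J S \<Longrightarrow> cost M (OPT M J) \<le> cost M S"
proof -
  obtain S0 where "is_arg_min (cost M) (\<lambda>S. S \<in> {S. feasible M J S}) S0"
    using ex_is_arg_min_if_finite[OF finite_feasible[OF assms], of "cost M"] feasible_exists[OF assms]
    by auto
  then have "is_arg_min (cost M) (feasible M J) S0" by simp
  then have "is_arg_min (cost M) (feasible M J) (OPT M J)"
    unfolding OPT_def arg_min_def by (rule someI)
  then show "feasible M J (OPT M J)"
    and "feasible M J S \<Longrightarrow> cost M (OPT M J) \<le> cost M S"
    by (auto simp: is_arg_min_linorder)
qed

end

theory Submission
  imports Defs
begin

text \<open>There are two machine types: a machine for a single job at price \<open>1\<close>, and one for \<open>4 * c\<close>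
  jobs at price \<open>c\<close>. The adversary plays phases. A phase starting at time \<open>s\<close> releases \<open>2 * c\<close>
  jobs with deadlines \<open>s, s + 1, \<dots>\<close>, and ends as soon as the algorithm uses the expensive type
  or the last deadline passes. A phase of \<open>q\<close> time steps costs the algorithm at least
  \<open>min q c + c - 1\<close>. Offline, an expensive batch at the start of a phase serves all jobs of
  this phase together with those left over from the preceding one; so in every second phase it suffices
  to process the jobs due before its end, at cost at most \<open>min q c\<close>. The two choices of parity
  together pay at most \<open>min q c + c\<close> per phase, and the better one costs about half as much as
  the algorithm.\<close>

section \<open>Costs and composition of feasible schedules\<close>

lemma finite_schedule:
  assumes "feasible M J S" "finite J"
  shows "finite S"
proof (rule finite_imageD)
  have "bjobs ` S \<subseteq> Pow J" using assms by (auto simp: feasible_def partition_on_def)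
  then show "finite (bjobs ` S)" using assms(2) by (meson finite_Pow_iff finite_subset)
  show "inj_on bjobs S" using assms by (simp add: feasible_def)
qed

lemma price_ge_1:
  assumes "valid_instance M J" "feasible M J S" "X \<in> S"
  shows "1 \<le> price (M ! btype X)"
  using assms by (auto simp: valid_instance_def feasible_def)

lemma cost_mono:
  assumes "valid_instance M J" "feasible M J S" "T \<subseteq> S"
  shows "cost M T \<le> cost M S"
  unfolding cost_def
proof (rule sum_mono2)
  show "finite S" using assms finite_schedule valid_instance_def by blast
  show "0 \<le> price (M ! btype X)" if "X \<in> S - T" for X
    using price_ge_1[OF assms(1,2), of X] that by simp
qed (fact assms(3))

lemma cost_ge_card:
  assumes "valid_instance M J" "feasible M J S" "T \<subseteq> S"
  shows "real (card T) \<le> cost M T"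
proof -
  have "real (card T) = (\<Sum>X\<in>T. 1)" by simp
  also have "\<dots> \<le> cost M T"
    unfolding cost_def by (rule sum_mono) (use price_ge_1[OF assms(1,2)] assms(3) in blast)
  finally show ?thesis .
qed

lemma cost_pos:
  assumes "valid_instance M J" "feasible M J S" "J \<noteq> {}"
  shows "0 < cost M S"
proof -
  have "finite S" using assms finite_schedule valid_instance_def by blast
  moreover have "S \<noteq> {}" using assms by (auto simp: feasible_def partition_on_def)
  ultimately have "0 < card S" by (simp add: card_gt_0_iff)
  then show ?thesis using cost_ge_card[OF assms(1,2) order_refl] by linarith
qed

text \<open>Batches of a feasible schedule are nonempty, so schedules of disjoint job sets never
  share a job set. This keeps \<open>bjobs\<close> injective on the union and makes costs
  additive.\<close>

lemma feasible_Un: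
  assumes "feasible M J S" "feasible M K T" "J \<inter> K = {}"
  shows "feasible M (J \<union> K) (S \<union> T)" and "S \<inter> T = {}"
proof -
  have sub: "bjobs X \<subseteq> J" "bjobs X \<noteq> {}" if "X \<in> S" for X
    using assms(1) that by (auto simp: feasible_def partition_on_def)
  have sub': "bjobs X \<subseteq> K" "bjobs X \<noteq> {}" if "X \<in> T" for X
    using assms(2) that by (auto simp: feasible_def partition_on_def)
  have ne: "bjobs X \<noteq> bjobs Y" if "X \<in> S" "Y \<in> T" for X Y
    using sub[OF that(1)] sub'[OF that(2)] assms(3) by blast
  then show "S \<inter> T = {}" by blast
  have "partition_on (J \<union> K) (bjobs ` S \<union> bjobs ` T)"
    using assms by (auto simp: feasible_def partition_on_def intro: disjoint_union)
  moreover have "inj_on bjobs (S \<union> T)"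
    using assms(1,2) ne unfolding feasible_def inj_on_def by (metis UnE)
  ultimately show "feasible M (J \<union> K) (S \<union> T)"
    using assms by (auto simp: feasible_def image_Un)
qed

lemma cost_Un:
  assumes "feasible M J S" "feasible M K T" "J \<inter> K = {}" "finite J" "finite K"
  shows "cost M (S \<union> T) = cost M S + cost M T"
  unfolding cost_def
  using assms finite_schedule feasible_Un(2) by (intro sum.union_disjoint) blast+

lemma feasible_single_batch:
  assumes "P \<noteq> {}" "k < length M" "card P \<le> capacity (M ! k)"
    "\<And>j. j \<in> P \<Longrightarrow> release j \<le> t \<and> t \<le> deadline j"
  shows "feasible M P {\<lparr>bjobs = P, btype = k, btime = t\<rparr>}"
  using assms by (auto simp: feasible_def partition_on_def)

text \<open>\<open>P\<close> may be empty, as happens when nothing was postponed. A partition has no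
  empty part, so that case takes the empty schedule, which is why the price is only an upper
  bound.\<close>

lemma feasible_batch_exists:
  assumes "k < length M" "card P \<le> capacity (M ! k)" "0 \<le> price (M ! k)"
    "\<And>j. j \<in> P \<Longrightarrow> release j \<le> t \<and> t \<le> deadline j"
  obtains S where "feasible M P S" "cost M S \<le> price (M ! k)"
proof (cases "P = {}")
  case True
  then have "feasible M P {}" by (simp add: feasible_def partition_on_def)
  then show ?thesis using that assms(3) by (force simp: cost_def)
next
  case False
  then show ?thesis using that[OF feasible_single_batch[OF False assms(1,2,4)]] by (simp add: cost_def)
qed

lemma feasible_singletons_exist:
  assumes "k < length M" "1 \<le> capacity (M ! k)" "\<And>j. j \<in> P \<Longrightarrow> release j \<le> deadline j"
  obtains S where "feasible M P S" "cost M S = real (card P) * price (M ! k)"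
proof -
  define b where "b = (\<lambda>j. \<lparr>bjobs = {j}, btype = k, btime = release j\<rparr>)"
  have inj: "inj_on b P" by (auto simp: b_def inj_on_def)
  have "feasible M P (b ` P)"
    using assms unfolding feasible_def partition_on_def disjoint_def inj_on_def b_def by auto
  moreover have "cost M (b ` P) = real (card P) * price (M ! k)"
    unfolding cost_def sum.reindex[OF inj] by (simp add: b_def)
  ultimately show ?thesis by (rule that)
qed

section \<open>Online decisions and the cost of one phase\<close>

definition schedule_before :: "batch set \<Rightarrow> int \<Rightarrow> batch set" where
  "schedule_before S s = {X \<in> S. btime X < s}"

text \<open>At a time \<open>t < s\<close> the algorithm sees only jobs released by
  \<open>t\<close>. Hence an adaptive adversary can be modelled by extending the instance: the new
  jobs leave all past decisions intact.\<close>

lemma schedule_before_extend: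
  assumes "\<And>j. j \<in> K \<Longrightarrow> s \<le> release j"
  shows "schedule_before (schedule_of A M (J \<union> K)) s = schedule_before (schedule_of A M J) s"
proof -
  have "{j \<in> J \<union> K. release j \<le> t} = {j \<in> J. release j \<le> t}" if "t < s" for t
    using assms that by force
  then show ?thesis by (auto simp: schedule_before_def schedule_of_def)
qed

text \<open>The capacity \<open>4 * c\<close> leaves room for up to \<open>2 * c\<close> postponed
  jobs together with the \<open>2 * c\<close> new ones.\<close>

definition two_types :: "nat \<Rightarrow> machine_type list" where
  "two_types c = [\<lparr>capacity = 1, price = 1\<rparr>, \<lparr>capacity = 4 * c, price = real c\<rparr>]"

text \<open>A constant label suffices: deadlines separate the jobs of a phase, and release times
  separate phases.\<close>

definition phase_job :: "int \<Rightarrow> nat \<Rightarrow> job" where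
  "phase_job s i = \<lparr>label = 0, release = s, deadline = s + int i\<rparr>"

lemma phase_job_simps [simp]:
  "release (phase_job s i) = s" "deadline (phase_job s i) = s + int i"
  "phase_job s i = phase_job s j \<longleftrightarrow> i = j"
  by (simp_all add: phase_job_def)

lemma inj_phase_job: "inj_on (phase_job s) I"
  by (simp add: inj_on_def)

lemma two_types_simps [simp]:
  "length (two_types c) = 2" "two_types c ! 0 = \<lparr>capacity = 1, price = 1\<rparr>"
  "two_types c ! Suc 0 = \<lparr>capacity = 4 * c, price = real c\<rparr>"
  by (simp_all add: two_types_def)

lemma valid_instance_two_types:
  assumes "1 \<le> c"
  shows "valid_instance (two_types c) J \<longleftrightarrow> finite J \<and> (\<forall>j\<in>J. release j \<le> deadline j)"
  using assms by (auto simp: valid_instance_def two_types_def)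

text \<open>Job \<open>i < k\<close> must run within the window because its deadline is
  \<open>s + i\<close>. A cheap batch holds one job, so distinct jobs force distinct
  batches.\<close>

lemma card_cheap_batches:
  assumes S: "feasible (two_types c) J S" and "finite J"
    and jobs: "phase_job s ` {..<k} \<subseteq> J"
    and cheap: "\<And>X. X \<in> S \<Longrightarrow> s \<le> btime X \<Longrightarrow> btime X < s + int k \<Longrightarrow> btype X = 0"
  shows "k \<le> card {X \<in> S. s \<le> btime X \<and> btime X < s + int k}"
proof -
  let ?T = "{X \<in> S. s \<le> btime X \<and> btime X < s + int k}"
  have "\<exists>X\<in>?T. bjobs X = {phase_job s i}" if "i < k" for i
  proof -
    have "phase_job s i \<in> \<Union> (bjobs ` S)"
      using S jobs that by (auto simp: feasible_def partition_on_def)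
    then obtain X where X: "X \<in> S" "phase_job s i \<in> bjobs X" by blast
    then have "s \<le> btime X" "btime X \<le> s + int i"
      using S unfolding feasible_def by force+
    then have T: "X \<in> ?T" using X(1) that by simp
    then have "btype X = 0" using cheap by simp
    then have "card (bjobs X) \<le> 1" using S X(1) by (auto simp: feasible_def)
    moreover have "bjobs X \<subseteq> J"
      using S X(1) by (auto simp: feasible_def partition_on_def)
    then have "finite (bjobs X)" using \<open>finite J\<close> finite_subset by blast
    ultimately have "bjobs X = {phase_job s i}"
      using X(2) card_seteq[of "bjobs X" "{phase_job s i}"] by simp
    then show ?thesis using T by blast
  qed
  then have "(\<lambda>i. {phase_job s i}) ` {..<k} \<subseteq> bjobs ` ?T"
    by (metis (no_types, lifting) image_eqI image_subsetI lessThan_iff)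
  moreover have fin: "finite ?T" using finite_schedule[OF S \<open>finite J\<close>] by simp
  moreover have "card ((\<lambda>i. {phase_job s i}) ` {..<k}) = k"
    by (subst card_image) (auto simp: inj_on_def)
  ultimately show ?thesis by (metis (lifting) card_image_le card_mono finite_imageI le_trans)
qed

text \<open>The witness \<open>q\<close> is the length of the phase: it ends right after the first
  time step with an expensive batch, or after \<open>2 * c\<close> steps if there is none.\<close>

lemma phase_cost:
  assumes c: "1 \<le> c" and valid: "valid_instance (two_types c) J"
    and S: "feasible (two_types c) J S" and jobs: "phase_job s ` {..<2 * c} \<subseteq> J"
  obtains q where "1 \<le> q" "q \<le> 2 * c"
    "cost (two_types c) (schedule_before S s) + real (min q c) + real c - 1
       \<le> cost (two_types c) (schedule_before S (s + int q))"
proof -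
  let ?M = "two_types c"
  define T where "T = (\<lambda>q. {X \<in> S. s \<le> btime X \<and> btime X < s + int q})"
  have finJ: "finite J" using valid c by (simp add: valid_instance_two_types)
  have finS: "finite S" by (rule finite_schedule[OF S finJ])
  have split: "cost ?M (schedule_before S (s + int q)) = cost ?M (schedule_before S s) + cost ?M (T q)" for q
  proof -
    have "schedule_before S (s + int q) = schedule_before S s \<union> T q"
      by (auto simp: schedule_before_def T_def)
    moreover have "schedule_before S s \<inter> T q = {}"
      by (auto simp: schedule_before_def T_def)
    ultimately show ?thesis
      unfolding cost_def using finS by (simp add: sum.union_disjoint schedule_before_def T_def)
  qed
  have cheap: "btype X = 0" if "X \<in> S" "btype X \<noteq> 1" for X
    using S that by (auto simp: feasible_def less_2_cases_iff)
  define used where "used = (\<lambda>i. \<exists>X\<in>S. btime X = s + int i \<and> btype X = 1)"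
  have card_T: "k \<le> card (T k)" if k: "k \<le> 2 * c" "\<And>i. i < k \<Longrightarrow> \<not> used i" for k
    unfolding T_def
  proof (rule card_cheap_batches[OF S finJ])
    show "phase_job s ` {..<k} \<subseteq> J" using jobs k(1) by (auto simp: image_subset_iff)
    show "btype X = 0" if X: "X \<in> S" "s \<le> btime X" "btime X < s + int k" for X
    proof (rule cheap[OF X(1)])
      have "nat (btime X - s) < k" using X by linarith
      then have "\<not> used (nat (btime X - s))" by (rule k(2))
      then show "btype X \<noteq> 1" using X unfolding used_def by auto
    qed
  qed
  have cost_T: "real (card (T q)) \<le> cost ?M (T q)" for q
    by (rule cost_ge_card[OF valid S]) (auto simp: T_def)
  show ?thesis
  proof (cases "\<exists>i<2 * c. used i")
    case False
    \<comment> \<open>Here \<open>min q c = c\<close>, so \<open>2 * c\<close> cheap batches exceed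
      the required \<open>c + c - 1\<close>.\<close>
    then have "2 * c \<le> card (T (2 * c))" by (intro card_T) auto
    then have "real (2 * c) \<le> cost ?M (T (2 * c))" using cost_T[of "2 * c"] by linarith
    then show ?thesis using c split[of "2 * c"] by (intro that[of "2 * c"]) auto
  next
    case True
    define k where "k = (LEAST i. used i)"
    have k: "used k" "k < 2 * c" "\<And>i. i < k \<Longrightarrow> \<not> used i"
      using True unfolding k_def
      by (metis LeastI, metis Least_le le_less_trans, metis not_less_Least)
    obtain X where X: "X \<in> S" "btime X = s + int k" "btype X = 1"
      using k(1) unfolding used_def by blast
    \<comment> \<open>With \<open>q = Suc k\<close>, the \<open>k\<close> forced cheap batches and
      the expensive \<open>X\<close> cost at least \<open>k + c = q + c - 1\<close>.\<close>
    have "X \<in> T (Suc k) - T k" using X by (auto simp: T_def)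
    then have ins: "insert X (T k) \<subseteq> T (Suc k)" "X \<notin> T k" by (auto simp: T_def)
    have "cost ?M (insert X (T k)) \<le> cost ?M (T (Suc k))"
      unfolding cost_def
    proof (rule sum_mono2[OF _ ins(1)])
      show "finite (T (Suc k))" using finS by (simp add: T_def)
      show "0 \<le> price (?M ! btype Y)" if "Y \<in> T (Suc k) - insert X (T k)" for Y
        using price_ge_1[OF valid S, of Y] that by (simp add: T_def)
    qed
    moreover have "cost ?M (insert X (T k)) = real c + cost ?M (T k)"
      using ins(2) finS X(3) by (simp add: cost_def T_def)
    moreover have "real k \<le> cost ?M (T k)"
      using card_T[of k] k(2,3) cost_T[of k] by fastforce
    ultimately show ?thesis
      using k(2) split[of "Suc k"] by (intro that[of "Suc k"]) auto
  qed
qed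

section \<open>Induction over the phases\<close>

text \<open>\<open>E\<close> and \<open>F\<close> are the two offline strategies: \<open>E\<close> has processed all jobs released so far,
  while \<open>F\<close> has postponed the jobs in \<open>R\<close>. They exchange roles after each phase.\<close>

definition adversary_state ::
    "algorithm \<Rightarrow> nat \<Rightarrow> nat \<Rightarrow> job set \<Rightarrow> int \<Rightarrow> job set \<Rightarrow> batch set \<Rightarrow> batch set \<Rightarrow> bool" where
  "adversary_state A c m J s R E F \<longleftrightarrow>
     valid_instance (two_types c) J \<and> (\<forall>j\<in>J. release j < s) \<and>
     R \<subseteq> J \<and> card R \<le> 2 * c \<and> (\<forall>j\<in>R. s \<le> deadline j) \<and>
     feasible (two_types c) J E \<and> feasible (two_types c) (J - R) F \<and>
     cost (two_types c) E + cost (two_types c) F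
       \<le> cost (two_types c) (schedule_before (schedule_of A (two_types c) J) s) + real m \<and>
     real m * real c \<le> cost (two_types c) (schedule_before (schedule_of A (two_types c) J) s)"

text \<open>In a phase the two strategies together pay at most \<open>min q c + c\<close>, and the
  algorithm at least one less than this; the deficit is the slack \<open>real m\<close>. The
  algorithm also pays at least \<open>c\<close> per phase, so this slack is small relative to its
  cost when \<open>c\<close> is large.\<close>

lemma adversary_state_Suc:
  assumes A: "online_algorithm A" and c: "1 \<le> c" and state: "adversary_state A c m J s R E F"
  shows "\<exists>J s R E F. adversary_state A c (Suc m) J s R E F"
proof -
  let ?M = "two_types c"
  let ?alg = "\<lambda>J. schedule_of A ?M J"
  have valid: "valid_instance ?M J" and rel: "\<And>j. j \<in> J \<Longrightarrow> release j < s"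
    and R: "R \<subseteq> J" "card R \<le> 2 * c" "\<And>j. j \<in> R \<Longrightarrow> s \<le> deadline j"
    and E: "feasible ?M J E" and F: "feasible ?M (J - R) F"
    and costs: "cost ?M E + cost ?M F \<le> cost ?M (schedule_before (?alg J) s) + real m"
      "real m * real c \<le> cost ?M (schedule_before (?alg J) s)"
    using state by (auto simp: adversary_state_def)
  have finJ: "finite J" using valid c by (simp add: valid_instance_two_types)
  define K where "K = phase_job s ` {..<2 * c}"
  have K: "finite K" "card K = 2 * c" "J \<inter> K = {}"
    by (auto simp: K_def card_image inj_phase_job dest!: rel)
  have relK: "release j = s" "s \<le> deadline j" if "j \<in> K" for j
    using that by (auto simp: K_def)
  have valid': "valid_instance ?M (J \<union> K)"
    using valid K(1) relK c by (auto simp: valid_instance_two_types)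
  then have alg: "feasible ?M (J \<union> K) (?alg (J \<union> K))"
    using A by (simp add: online_algorithm_def)
  have same: "schedule_before (?alg (J \<union> K)) s = schedule_before (?alg J) s"
    by (rule schedule_before_extend) (simp add: relK)
  obtain q where q: "1 \<le> q" "q \<le> 2 * c"
    and phase: "cost ?M (schedule_before (?alg J) s) + real (min q c) + real c - 1
       \<le> cost ?M (schedule_before (?alg (J \<union> K)) (s + int q))"
    using phase_cost[OF c valid' alg, of s] unfolding same by (auto simp: K_def)
  \<comment> \<open>The new \<open>E'\<close> continues \<open>F\<close>: one expensive batch at
    time \<open>s\<close> clears both the postponed \<open>R\<close> and the new
    \<open>K\<close>.\<close>
  obtain E' where E': "feasible ?M (J \<union> K) E'" "cost ?M E' \<le> cost ?M F + real c"
  proof -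
    have fin: "finite (R \<union> K)" "finite (J - R)" using finite_subset[OF R(1) finJ] finJ K(1) by auto
    have "card (R \<union> K) \<le> card R + card K" by (rule card_Un_le)
    then have "card (R \<union> K) \<le> 4 * c" using R(2) K(2) by linarith
    moreover have "release j \<le> s \<and> s \<le> deadline j" if "j \<in> R \<union> K" for j
      using that R rel relK by force
    ultimately obtain B where B: "feasible ?M (R \<union> K) B" "cost ?M B \<le> real c"
      using feasible_batch_exists[of 1 ?M "R \<union> K" s] by auto
    have disj: "(J - R) \<inter> (R \<union> K) = {}" using K(3) by blast
    have "(J - R) \<union> (R \<union> K) = J \<union> K" using R(1) by blast
    then show ?thesis
      using that[of "F \<union> B"] feasible_Un(1)[OF F B(1) disj] cost_Un[OF F B(1) disj fin(2,1)] B(2)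
      by simp
  qed
  \<comment> \<open>The new \<open>F'\<close> continues \<open>E\<close>. For
    \<open>q \<le> c\<close> it runs singly the \<open>q\<close> jobs due before
    \<open>s + q\<close> and postpones the rest of \<open>K\<close>; otherwise one expensive batch
    for all of \<open>K\<close> is cheaper and nothing is postponed.\<close>
  obtain R' F' where R': "R' \<subseteq> K" "\<And>j. j \<in> R' \<Longrightarrow> s + int q \<le> deadline j"
    and F': "feasible ?M (J \<union> K - R') F'" "cost ?M F' \<le> cost ?M E + real (min q c)"
  proof (cases "q \<le> c")
    case True
    define P where "P = phase_job s ` {..<q}"
    have P: "P \<subseteq> K" "finite P" "card P = q"
      using q(2) by (auto simp: P_def K_def card_image inj_phase_job)
    obtain B where B: "feasible ?M P B" "cost ?M B = real q"
      using feasible_singletons_exist[of 0 ?M P] P relK by (force simp: subset_iff)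
    have disj: "J \<inter> P = {}" using K(3) P(1) by blast
    have "J \<union> K - (K - P) = J \<union> P" using K(3) P(1) by blast
    moreover have "s + int q \<le> deadline j" if "j \<in> K - P" for j
      using that by (force simp: K_def P_def)
    ultimately show ?thesis
      using that[of "K - P" "E \<union> B"] feasible_Un(1)[OF E B(1) disj]
        cost_Un[OF E B(1) disj finJ P(2)] B(2) True by simp
  next
    case False
    obtain B where B: "feasible ?M K B" "cost ?M B \<le> real c"
      using feasible_batch_exists[of 1 ?M K s] K(2) relK by auto
    show ?thesis
      using that[of "{}" "E \<union> B"] feasible_Un(1)[OF E B(1) K(3)]
        cost_Un[OF E B(1) K(3) finJ K(1)] B(2) False by simp
  qed
  have "card R' \<le> 2 * c" using card_mono[OF K(1) R'(1)] K(2) by simp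
  moreover have "release j < s + int q" if "j \<in> J \<union> K" for j
    using that rel[of j] relK(1)[of j] q(1) by auto
  moreover have "cost ?M E' + cost ?M F'
      \<le> cost ?M (schedule_before (?alg (J \<union> K)) (s + int q)) + real (Suc m)"
    using E'(2) F'(2) phase costs(1) by simp
  moreover have "real (Suc m) * real c \<le> cost ?M (schedule_before (?alg (J \<union> K)) (s + int q))"
  proof -
    \<comment> \<open>This compensates the \<open>- 1\<close> in \<open>phase\<close>, leaving a
      full \<open>c\<close>.\<close>
    have "1 \<le> real (min q c)" using q(1) c by simp
    moreover have "real (Suc m) * real c = real m * real c + real c" by (simp add: algebra_simps)
    ultimately show ?thesis using phase costs(2) by linarith
  qed
  ultimately have "adversary_state A c (Suc m) (J \<union> K) (s + int q) R' E' F'"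
    using valid' R' E'(1) F'(1) by (auto simp: adversary_state_def)
  then show ?thesis by blast
qed

lemma adversary_state_exists:
  assumes "online_algorithm A" "1 \<le> c"
  shows "\<exists>J s R E F. adversary_state A c m J s R E F"
proof (induction m)
  case 0
  have valid: "valid_instance (two_types c) {}" using assms(2) by (simp add: valid_instance_two_types)
  have "feasible (two_types c) {} {}" by (simp add: feasible_def partition_on_def)
  moreover have "feasible (two_types c) {} (schedule_of A (two_types c) {})"
    using valid assms(1) by (simp add: online_algorithm_def)
  then have "schedule_of A (two_types c) {} = {}"
    by (auto simp: feasible_def partition_on_def)
  ultimately have "adversary_state A c 0 {} 0 {} {} {}"
    using valid by (simp add: adversary_state_def cost_def schedule_before_def)
  then show ?case by blast
next
  case (Suc m)
  then show ?case using adversary_state_Suc[OF assms] by blast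
qed

section \<open>From phases to the competitive ratio\<close>

text \<open>After \<open>c\<close> phases, one more expensive batch for \<open>R\<close> completes
  \<open>F\<close>. Averaging it with \<open>E\<close> bounds twice the optimum by the algorithm's
  cost plus \<open>2 * c\<close>, and this excess is at most \<open>2 / c\<close> times the
  algorithm's cost, which is at least \<open>c * c\<close>.\<close>

lemma hard_instance:
  assumes A: "online_algorithm A" and c: "1 \<le> c"
  obtains J where "valid_instance (two_types c) J" "J \<noteq> {}"
    "2 * real c * cost (two_types c) (OPT (two_types c) J)
       \<le> (real c + 2) * cost (two_types c) (schedule_of A (two_types c) J)"
proof -
  let ?M = "two_types c"
  obtain J s R E F where state: "adversary_state A c c J s R E F"
    using adversary_state_exists[OF A c] by blast
  let ?S = "schedule_of A ?M J"
  have valid: "valid_instance ?M J" and rel: "\<And>j. j \<in> J \<Longrightarrow> release j < s"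
    and R: "R \<subseteq> J" "card R \<le> 2 * c" "\<And>j. j \<in> R \<Longrightarrow> s \<le> deadline j"
    and E: "feasible ?M J E" and F: "feasible ?M (J - R) F"
    and costs: "cost ?M E + cost ?M F \<le> cost ?M (schedule_before ?S s) + real c"
      "real c * real c \<le> cost ?M (schedule_before ?S s)"
    using state by (auto simp: adversary_state_def)
  have finJ: "finite J" using valid c by (simp add: valid_instance_two_types)
  have S: "feasible ?M J ?S" using A valid by (simp add: online_algorithm_def)
  have mono: "cost ?M (schedule_before ?S s) \<le> cost ?M ?S"
    by (rule cost_mono[OF valid S]) (auto simp: schedule_before_def)
  have "release j \<le> s \<and> s \<le> deadline j" if "j \<in> R" for j
    using that R rel by force
  then obtain B where B: "feasible ?M R B" "cost ?M B \<le> real c"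
    using feasible_batch_exists[of 1 ?M R s] R(2) by auto
  have disj: "(J - R) \<inter> R = {}" and un: "(J - R) \<union> R = J" using R(1) by blast+
  have "cost ?M (OPT ?M J) \<le> cost ?M (F \<union> B)"
    using OPT_optimal(2)[OF valid] feasible_Un(1)[OF F B(1) disj] un by simp
  also have "\<dots> \<le> cost ?M F + real c"
    using cost_Un[OF F B(1) disj] B(2) finJ finite_subset[OF R(1) finJ] by simp
  finally have "2 * cost ?M (OPT ?M J) \<le> cost ?M ?S + 2 * real c"
    using OPT_optimal(2)[OF valid E] costs(1) mono by linarith
  then have "real c * (2 * cost ?M (OPT ?M J)) \<le> real c * (cost ?M ?S + 2 * real c)"
    by (rule mult_left_mono) simp
  then have "2 * real c * cost ?M (OPT ?M J) \<le> (real c + 2) * cost ?M ?S"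
    using costs(2) mono by (simp add: algebra_simps)
  moreover have "J \<noteq> {}"
  proof
    assume "J = {}"
    then have "?S = {}" using S by (auto simp: feasible_def partition_on_def)
    moreover have "1 \<le> real c * real c" using c mult_mono[of 1 "real c" 1 "real c"] by simp
    ultimately show False using costs(2) by (simp add: schedule_before_def cost_def)
  qed
  ultimately show ?thesis using that valid by blast
qed

lemma ratio_exceeds:
  fixes \<alpha> :: real
  assumes A: "online_algorithm A" and "\<alpha> < 2"
  obtains M J where "valid_instance M J" "J \<noteq> {}" "0 < cost M (OPT M J)"
    "\<alpha> * cost M (OPT M J) < cost M (schedule_of A M J)"
proof -
  \<comment> \<open>The threshold comes from solving \<open>\<alpha> < 2 * c / (c + 2)\<close> for
    \<open>c\<close>; the successor also ensures \<open>1 \<le> c\<close>.\<close>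
  obtain n :: nat where n: "2 * \<alpha> / (2 - \<alpha>) < real n" using reals_Archimedean2 by blast
  define c where "c = Suc n"
  have c: "1 \<le> c" "2 * \<alpha> < real c * (2 - \<alpha>)"
    using n assms(2) by (auto simp: c_def field_simps)
  let ?M = "two_types c"
  obtain J where J: "valid_instance ?M J" "J \<noteq> {}"
    "2 * real c * cost ?M (OPT ?M J) \<le> (real c + 2) * cost ?M (schedule_of A ?M J)"
    using hard_instance[OF A c(1)] by blast
  have pos: "0 < cost ?M (OPT ?M J)"
    using cost_pos[OF J(1) OPT_optimal(1)[OF J(1)] J(2)] .
  have "(real c + 2) * \<alpha> < 2 * real c" using c(2) by (simp add: algebra_simps)
  then have "(real c + 2) * \<alpha> * cost ?M (OPT ?M J) < 2 * real c * cost ?M (OPT ?M J)"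
    using pos by (rule mult_strict_right_mono)
  then have "(real c + 2) * (\<alpha> * cost ?M (OPT ?M J)) < (real c + 2) * cost ?M (schedule_of A ?M J)"
    using J(3) by (simp only: mult.assoc)
  then have "\<alpha> * cost ?M (OPT ?M J) < cost ?M (schedule_of A ?M J)"
    by (rule mult_left_less_imp_less) simp
  then show ?thesis using that J(1,2) pos by blast
qed

theorem theorem3:
  fixes A :: algorithm
  assumes "online_algorithm A"
  shows "competitive_ratio A \<ge> 2 \<and>
    (\<forall>\<alpha>::real. \<alpha> < 2 \<longrightarrow>
      (\<exists>M J. valid_instance M J \<and> cost M (schedule_of A M J) > \<alpha> * cost M (OPT M J)))"
proof
  show "2 \<le> competitive_ratio A"
  \<comment> \<open>The guaranteed ratios \<open>2 * c / (c + 2)\<close> only approach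
    \<open>2\<close>, so each \<open>x < 2\<close> gets its own instance.\<close>
  proof (rule dense_le)
    fix x :: ereal assume x: "x < 2"
    show "x \<le> competitive_ratio A"
    proof (cases x)
      case (real \<alpha>)
      then have "\<alpha> < 2" using x by simp
      then obtain M J where MJ: "valid_instance M J" "J \<noteq> {}" "0 < cost M (OPT M J)"
        "\<alpha> * cost M (OPT M J) < cost M (schedule_of A M J)"
        using ratio_exceeds[OF assms] by blast
      have "x \<le> ereal (cost M (schedule_of A M J) / cost M (OPT M J))"
        using MJ(3,4) real by (simp add: pos_le_divide_eq)
      also have "\<dots> \<le> competitive_ratio A"
        unfolding competitive_ratio_def using MJ(1,2) by (intro SUP_upper2[of "(M, J)"]) auto
      finally show ?thesis .
    qed (use x in auto)
  qed
  show "\<forall>\<alpha>::real. \<alpha> < 2 \<longrightarrow>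
      (\<exists>M J. valid_instance M J \<and> cost M (schedule_of A M J) > \<alpha> * cost M (OPT M J))"
    using ratio_exceeds[OF assms] by metis
qed

end
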